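(* There exists a causally continuous (and in particular reflecting) spacetime $(M,g)$ whose universal covering spacetime $(\tilde M,\tilde g)$ is not past reflecting.
   Context: A spacetime $(M,g)$ is a connected, Hausdorff, second-countable $C^\infty$ manifold $M$ of dimension at least $2$ with a time-oriented $C^\infty$ Lorentzian metric $g$. The universal covering spacetime of $(M,g)$ is the universal covering manifold $\pi:\tilde M\to M$ endowed with $\tilde g=\pi^*g$ and the induced time-orientation. $I^+(p)$ [resp. $I^-(p)$] is the set of points that can be reached from $p$ by a future-directed [resp. past-directed] timelike curve. A spacetime is past reflecting if for all points $p,q$: $q\in\overline{I^+(p)}\Rightarrow p\in\overline{I^-(q)}$; it is future reflecting if for all $p,q$: $q\in\overline{I^-(p)}\Rightarrow p\in\overline{I^+(q)}$; it is reflecting if it is both past and future reflecting. A spacetime is distinguishing if for all $p,q$, $I^+(p)=I^+(q)$ implies $p=q$, and $I^-(p)=I^-(q)$ implies $p=q$. A spacetime is causally continuous if it is distinguishing and reflecting. *)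

theory Defs
  imports "HOL-Analysis.Analysis"
begin

section \<open>Smooth functions on open subsets of Euclidean n-space\<close>

text \<open>
  Points of n-space are the points of \<^const>\<open>Euclidean_space\<close>, that is, functions
  \<^typ>\<open>nat \<Rightarrow> real\<close> vanishing at all indices \<open>\<ge> n\<close>. This keeps the dimension a
  number rather than a type, so that it can be quantified inside a statement.
\<close>

definition partial_deriv :: "nat \<Rightarrow> ((nat \<Rightarrow> real) \<Rightarrow> real) \<Rightarrow> (nat \<Rightarrow> real) \<Rightarrow> real" where
  "partial_deriv i f x = deriv (\<lambda>t. f (x(i := t))) (x i)"

text \<open>
  On an open set \<open>V\<close>: partial derivatives of all orders exist and are continuous.
  The list \<open>is\<close> is a multi-index; the empty list gives \<open>f\<close> itself.
\<close>

definition smooth_on :: "nat \<Rightarrow> (nat \<Rightarrow> real) set \<Rightarrow> ((nat \<Rightarrow> real) \<Rightarrow> real) \<Rightarrow> bool" where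
  "smooth_on n V f \<longleftrightarrow>
     (\<forall>is. set is \<subseteq> {..<n} \<longrightarrow>
        continuous_map (subtopology (Euclidean_space n) V) euclideanreal (foldr partial_deriv is f) \<and>
        (\<forall>x\<in>V. \<forall>i<n. (\<lambda>t. foldr partial_deriv is f (x(i := t))) differentiable (at (x i))))"


section \<open>Smooth manifolds\<close>

type_synonym 'a chart = "'a set \<times> ('a \<Rightarrow> nat \<Rightarrow> real)"

abbreviation chart_dom :: "'a chart \<Rightarrow> 'a set" where
  "chart_dom c \<equiv> fst c"

abbreviation chart_map :: "'a chart \<Rightarrow> 'a \<Rightarrow> nat \<Rightarrow> real" where
  "chart_map c \<equiv> snd c"

definition chart_inv :: "'a chart \<Rightarrow> (nat \<Rightarrow> real) \<Rightarrow> 'a" where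
  "chart_inv c = inv_into (chart_dom c) (chart_map c)"

definition coord_rep ::
    "'a chart \<Rightarrow> 'b chart \<Rightarrow> ('a \<Rightarrow> 'b) \<Rightarrow> (nat \<Rightarrow> real) \<Rightarrow> nat \<Rightarrow> real" where
  "coord_rep c d f x = chart_map d (f (chart_inv c x))"

text \<open>\<open>jacobian c d f p k i\<close> is the derivative of the k-th coordinate of \<open>f\<close> in the i-th direction.\<close>

definition jacobian ::
    "'a chart \<Rightarrow> 'b chart \<Rightarrow> ('a \<Rightarrow> 'b) \<Rightarrow> 'a \<Rightarrow> nat \<Rightarrow> nat \<Rightarrow> real" where
  "jacobian c d f p k i = partial_deriv i (\<lambda>x. coord_rep c d f x k) (chart_map c p)"

record 'a mfd =
  mtop :: "'a topology"
  mdim :: nat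
  atlas :: "'a chart set"

definition is_chart :: "('a, 'z) mfd_scheme \<Rightarrow> 'a chart \<Rightarrow> bool" where
  "is_chart M c \<longleftrightarrow>
     openin (mtop M) (chart_dom c) \<and>
     openin (Euclidean_space (mdim M)) (chart_map c ` chart_dom c) \<and>
     homeomorphic_map (subtopology (mtop M) (chart_dom c))
       (subtopology (Euclidean_space (mdim M)) (chart_map c ` chart_dom c)) (chart_map c)"

text \<open>
  The atlas need not be maximal; it determines a smooth structure in the usual way.
\<close>

definition smooth_manifold :: "('a, 'z) mfd_scheme \<Rightarrow> bool" where
  "smooth_manifold M \<longleftrightarrow>
     Hausdorff_space (mtop M) \<and> second_countable (mtop M) \<and>
     (\<forall>c\<in>atlas M. is_chart M c) \<and>
     (\<Union>c\<in>atlas M. chart_dom c) = topspace (mtop M) \<and>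
     (\<forall>c\<in>atlas M. \<forall>d\<in>atlas M. \<forall>k<mdim M.
        smooth_on (mdim M) (chart_map c ` (chart_dom c \<inter> chart_dom d))
          (\<lambda>x. coord_rep c d id x k))"

definition smooth_map_on ::
    "('a, 'y) mfd_scheme \<Rightarrow> 'a set \<Rightarrow> ('b, 'z) mfd_scheme \<Rightarrow> ('a \<Rightarrow> 'b) \<Rightarrow> bool" where
  "smooth_map_on M S N f \<longleftrightarrow>
     continuous_map (subtopology (mtop M) S) (mtop N) f \<and>
     (\<forall>c\<in>atlas M. \<forall>d\<in>atlas N. \<forall>k<mdim N.
        smooth_on (mdim M) (chart_map c ` (chart_dom c \<inter> S \<inter> f -` chart_dom d))
          (\<lambda>x. coord_rep c d f x k))"


section \<open>Lorentzian metrics and time orientations\<close>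

text \<open>
  Tensor fields are given by their components in every chart of the atlas, subject to the
  transformation law. A tangent vector at \<open>p\<close> is likewise given, in a chart \<open>c\<close> around \<open>p\<close>,
  by its components \<open>v i\<close> for \<open>i < mdim M\<close>. The time orientation is represented by a
  continuous timelike vector field.
\<close>

record 'a lorentz_mfd = "'a mfd" +
  metric :: "'a chart \<Rightarrow> 'a \<Rightarrow> nat \<Rightarrow> nat \<Rightarrow> real"
  tfield :: "'a chart \<Rightarrow> 'a \<Rightarrow> nat \<Rightarrow> real"

definition gprod ::
    "('a, 'z) lorentz_mfd_scheme \<Rightarrow> 'a chart \<Rightarrow> 'a \<Rightarrow> (nat \<Rightarrow> real) \<Rightarrow> (nat \<Rightarrow> real) \<Rightarrow> real" where
  "gprod M c p v w = (\<Sum>i<mdim M. \<Sum>j<mdim M. metric M c p i j * v i * w j)"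

definition pushforward ::
    "('a, 'z) mfd_scheme \<Rightarrow> 'a chart \<Rightarrow> 'b chart \<Rightarrow> ('a \<Rightarrow> 'b) \<Rightarrow> 'a \<Rightarrow> (nat \<Rightarrow> real) \<Rightarrow> nat \<Rightarrow> real" where
  "pushforward M c d f p v k = (\<Sum>i<mdim M. jacobian c d f p k i * v i)"

text \<open>\<open>pullback_metric\<close>: components, in the chart \<open>c\<close> of \<open>M\<close>, of the pullback by \<open>f\<close> of the metric of \<open>N\<close>.\<close>

definition pullback_metric ::
    "('b, 'z) lorentz_mfd_scheme \<Rightarrow> 'a chart \<Rightarrow> 'b chart \<Rightarrow> ('a \<Rightarrow> 'b) \<Rightarrow> 'a \<Rightarrow> nat \<Rightarrow> nat \<Rightarrow> real" where
  "pullback_metric N c d f p i j =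
     (\<Sum>k<mdim N. \<Sum>l<mdim N.
        metric N d (f p) k l * jacobian c d f p k i * jacobian c d f p l j)"

text \<open>Signature \<open>(-,+,\<dots>,+)\<close>: there is an orthonormal basis \<open>e 0, \<dots>, e (n - 1)\<close> with \<open>e 0\<close> timelike.
  (Linear independence of the \<open>e a\<close> is forced by the Gram matrix.)\<close>

definition lorentzian_form :: "nat \<Rightarrow> (nat \<Rightarrow> nat \<Rightarrow> real) \<Rightarrow> bool" where
  "lorentzian_form n B \<longleftrightarrow>
     (\<forall>i<n. \<forall>j<n. B i j = B j i) \<and>
     (\<exists>e :: nat \<Rightarrow> nat \<Rightarrow> real. \<forall>a<n. \<forall>b<n.
        (\<Sum>i<n. \<Sum>j<n. B i j * e a i * e b j) =
          (if a \<noteq> b then 0 else if a = 0 then - 1 else 1))"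

definition lorentzian_metric :: "('a, 'z) lorentz_mfd_scheme \<Rightarrow> bool" where
  "lorentzian_metric M \<longleftrightarrow>
     (\<forall>c\<in>atlas M.
        (\<forall>p\<in>chart_dom c. lorentzian_form (mdim M) (metric M c p)) \<and>
        (\<forall>i<mdim M. \<forall>j<mdim M.
           smooth_on (mdim M) (chart_map c ` chart_dom c) (\<lambda>x. metric M c (chart_inv c x) i j))) \<and>
     (\<forall>c\<in>atlas M. \<forall>d\<in>atlas M. \<forall>p\<in>chart_dom c \<inter> chart_dom d. \<forall>i<mdim M. \<forall>j<mdim M.
        metric M c p i j = pullback_metric M c d id p i j)"

definition time_orientation :: "('a, 'z) lorentz_mfd_scheme \<Rightarrow> bool" where
  "time_orientation M \<longleftrightarrow>
     (\<forall>c\<in>atlas M.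
        (\<forall>p\<in>chart_dom c. gprod M c p (tfield M c p) (tfield M c p) < 0) \<and>
        (\<forall>i<mdim M.
           continuous_map (subtopology (mtop M) (chart_dom c)) euclideanreal (\<lambda>p. tfield M c p i))) \<and>
     (\<forall>c\<in>atlas M. \<forall>d\<in>atlas M. \<forall>p\<in>chart_dom c \<inter> chart_dom d. \<forall>k<mdim M.
        tfield M d p k = pushforward M c d id p (tfield M c p) k)"

definition spacetime :: "('a, 'z) lorentz_mfd_scheme \<Rightarrow> bool" where
  "spacetime M \<longleftrightarrow>
     smooth_manifold M \<and> topspace (mtop M) \<noteq> {} \<and> connected_space (mtop M) \<and> mdim M \<ge> 2 \<and>
     lorentzian_metric M \<and> time_orientation M"


section \<open>Timelike curves and causality conditions\<close>

definition future_timelike ::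
    "('a, 'z) lorentz_mfd_scheme \<Rightarrow> 'a chart \<Rightarrow> 'a \<Rightarrow> (nat \<Rightarrow> real) \<Rightarrow> bool" where
  "future_timelike M c p v \<longleftrightarrow> gprod M c p v v < 0 \<and> gprod M c p v (tfield M c p) < 0"

definition past_timelike ::
    "('a, 'z) lorentz_mfd_scheme \<Rightarrow> 'a chart \<Rightarrow> 'a \<Rightarrow> (nat \<Rightarrow> real) \<Rightarrow> bool" where
  "past_timelike M c p v \<longleftrightarrow> gprod M c p v v < 0 \<and> gprod M c p v (tfield M c p) > 0"

text \<open>Velocities at the endpoints of \<open>{a..b}\<close> are one-sided.\<close>

definition velocity ::
    "'a chart \<Rightarrow> (real \<Rightarrow> 'a) \<Rightarrow> real \<Rightarrow> real \<Rightarrow> real \<Rightarrow> nat \<Rightarrow> real" where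
  "velocity c \<gamma> a b t i = vector_derivative (\<lambda>s. chart_map c (\<gamma> s) i) (at t within {a..b})"

definition C1_curve :: "('a, 'z) mfd_scheme \<Rightarrow> (real \<Rightarrow> 'a) \<Rightarrow> real \<Rightarrow> real \<Rightarrow> bool" where
  "C1_curve M \<gamma> a b \<longleftrightarrow>
     continuous_map (top_of_set {a..b}) (mtop M) \<gamma> \<and>
     (\<forall>c\<in>atlas M. \<forall>i<mdim M.
        (\<forall>t\<in>{a..b}. \<gamma> t \<in> chart_dom c \<longrightarrow>
           (\<lambda>s. chart_map c (\<gamma> s) i) differentiable (at t within {a..b})) \<and>
        continuous_on {t\<in>{a..b}. \<gamma> t \<in> chart_dom c} (\<lambda>t. velocity c \<gamma> a b t i))"

text \<open>
  Timelike curves are piecewise continuously differentiable; at a break point both one-sided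
  velocities must be timelike with the prescribed direction. The parameter \<open>D\<close>
  is \<^const>\<open>future_timelike\<close> or \<^const>\<open>past_timelike\<close>.
\<close>

definition timelike_curve ::
    "('a lorentz_mfd \<Rightarrow> 'a chart \<Rightarrow> 'a \<Rightarrow> (nat \<Rightarrow> real) \<Rightarrow> bool) \<Rightarrow>
     'a lorentz_mfd \<Rightarrow> (real \<Rightarrow> 'a) \<Rightarrow> real \<Rightarrow> real \<Rightarrow> bool" where
  "timelike_curve D M \<gamma> a b \<longleftrightarrow>
     (\<exists>(m::nat) s :: nat \<Rightarrow> real. 0 < m \<and> s 0 = a \<and> s m = b \<and>
        (\<forall>k<m. s k < s (Suc k) \<and> C1_curve M \<gamma> (s k) (s (Suc k)) \<and>
           (\<forall>c\<in>atlas M. \<forall>t\<in>{s k..s (Suc k)}. \<gamma> t \<in> chart_dom c \<longrightarrow>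
              D M c (\<gamma> t) (velocity c \<gamma> (s k) (s (Suc k)) t))))"

definition chron_future :: "'a lorentz_mfd \<Rightarrow> 'a \<Rightarrow> 'a set" where
  "chron_future M p =
     {q. \<exists>\<gamma> a b. timelike_curve future_timelike M \<gamma> a b \<and> \<gamma> a = p \<and> \<gamma> b = q}"

definition chron_past :: "'a lorentz_mfd \<Rightarrow> 'a \<Rightarrow> 'a set" where
  "chron_past M p =
     {q. \<exists>\<gamma> a b. timelike_curve past_timelike M \<gamma> a b \<and> \<gamma> a = p \<and> \<gamma> b = q}"

definition past_reflecting :: "'a lorentz_mfd \<Rightarrow> bool" where
  "past_reflecting M \<longleftrightarrow>
     (\<forall>p\<in>topspace (mtop M). \<forall>q\<in>topspace (mtop M).
        q \<in> mtop M closure_of chron_future M p \<longrightarrow> p \<in> mtop M closure_of chron_past M q)"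

definition future_reflecting :: "'a lorentz_mfd \<Rightarrow> bool" where
  "future_reflecting M \<longleftrightarrow>
     (\<forall>p\<in>topspace (mtop M). \<forall>q\<in>topspace (mtop M).
        q \<in> mtop M closure_of chron_past M p \<longrightarrow> p \<in> mtop M closure_of chron_future M q)"

definition reflecting :: "'a lorentz_mfd \<Rightarrow> bool" where
  "reflecting M \<longleftrightarrow> past_reflecting M \<and> future_reflecting M"

definition distinguishing :: "'a lorentz_mfd \<Rightarrow> bool" where
  "distinguishing M \<longleftrightarrow>
     (\<forall>p\<in>topspace (mtop M). \<forall>q\<in>topspace (mtop M).
        (chron_future M p = chron_future M q \<longrightarrow> p = q) \<and>
        (chron_past M p = chron_past M q \<longrightarrow> p = q))"

definition causally_continuous :: "'a lorentz_mfd \<Rightarrow> bool" where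
  "causally_continuous M \<longleftrightarrow> distinguishing M \<and> reflecting M"


section \<open>Universal covering spacetimes\<close>

text \<open>
  Counterpart for abstract topologies of \<^const>\<open>simply_connected\<close>, which is only available
  for subsets of a topological type class. As there, path-connectedness is included,
  because constant loops at any two points are required to be homotopic.
\<close>

definition simply_connected_space :: "'a topology \<Rightarrow> bool" where
  "simply_connected_space X \<longleftrightarrow>
     (\<forall>p q. pathin X p \<and> p 1 = p 0 \<and> pathin X q \<and> q 1 = q 0 \<longrightarrow>
        homotopic_with (\<lambda>r. r 1 = r 0) (top_of_set {0..1}) X p q)"

text \<open>
  Modelled on \<^const>\<open>covering_space\<close>, with the sheets mapped diffeomorphically.
\<close>

definition smooth_covering :: "('a, 'y) mfd_scheme \<Rightarrow> ('a \<Rightarrow> 'b) \<Rightarrow> ('b, 'z) mfd_scheme \<Rightarrow> bool" where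
  "smooth_covering E \<pi> M \<longleftrightarrow>
     continuous_map (mtop E) (mtop M) \<pi> \<and>
     \<pi> ` topspace (mtop E) = topspace (mtop M) \<and>
     (\<forall>x\<in>topspace (mtop M). \<exists>T. x \<in> T \<and> openin (mtop M) T \<and>
        (\<exists>\<V>. \<Union>\<V> = topspace (mtop E) \<inter> \<pi> -` T \<and>
           (\<forall>U\<in>\<V>. openin (mtop E) U) \<and> pairwise disjnt \<V> \<and>
           (\<forall>U\<in>\<V>. \<exists>\<sigma>.
              homeomorphic_maps (subtopology (mtop E) U) (subtopology (mtop M) T) \<pi> \<sigma> \<and>
              smooth_map_on E U M \<pi> \<and> smooth_map_on M T E \<sigma>)))"

text \<open>
  \<open>E\<close> with projection \<open>\<pi>\<close> is the universal covering manifold of \<open>M\<close>, carries the pulled back metric,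
  and has the induced time orientation: a tangent vector of \<open>E\<close> is
  future-directed timelike iff its image under the differential of \<open>\<pi>\<close> is. The universal
  covering spacetime is unique up to isomorphism, and is characterised rather than constructed.

  On carrier types: a second-countable Hausdorff manifold and its universal cover have at most
  continuum many points, so up to isomorphism quantification over all spacetimes is
  quantification over \<^typ>\<open>(nat \<Rightarrow> real) lorentz_mfd\<close>.
\<close>

definition universal_covering_spacetime ::
    "'a lorentz_mfd \<Rightarrow> ('a \<Rightarrow> 'b) \<Rightarrow> 'b lorentz_mfd \<Rightarrow> bool" where
  "universal_covering_spacetime E \<pi> M \<longleftrightarrow>
     spacetime E \<and> spacetime M \<and>
     simply_connected_space (mtop E) \<and> smooth_covering E \<pi> M \<and>
     (\<forall>c\<in>atlas E. \<forall>d\<in>atlas M. \<forall>p\<in>chart_dom c \<inter> \<pi> -` chart_dom d.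
        (\<forall>i<mdim E. \<forall>j<mdim E. metric E c p i j = pullback_metric M c d \<pi> p i j) \<and>
        (\<forall>v. future_timelike E c p v \<longleftrightarrow>
           future_timelike M d (\<pi> p) (pushforward E c d \<pi> p v)))"

end

theory Submission
  imports Defs "HOL-Complex_Analysis.Complex_Analysis"
begin

text \<open>
  The example is the Minkowski plane without the origin, in null coordinates \<open>(a, b)\<close>: the metric is
  \<open>- da db\<close>, and a curve is future-directed timelike iff \<open>a\<close> and \<open>b\<close> both increase with positive
  derivatives.

  In the punctured plane one point lies in the chronological future of another iff both its null
  coordinates are larger, exactly as in the full plane, since a timelike curve through the origin can
  be bent around it (\<open>chron_punctured\<close>). So the closure of a chronological future or past is a closed
  quadrant without the origin (\<open>closure_chron_punctured\<close>), and causal continuity can be read off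
  (\<open>causally_continuous_punctured\<close>).

  In the universal covering it matters on which side of the origin a curve passes. Put \<open>p = (- 1, 0)\<close>
  and \<open>q = (1, 0)\<close>. Since \<open>b\<close> increases, future-directed curves starting at \<open>p\<close> run through
  \<open>b > 0\<close>, above the origin; they come arbitrarily close to \<open>q\<close> (\<open>chron_cover_half_turn\<close>). Past-directed
  curves starting at \<open>q\<close> run through \<open>b < 0\<close>, below the origin (\<open>chron_past_cover_origin\<close>). So if \<open>p\<close>
  and \<open>q\<close> are lifted to points joined by a path above the origin, then the lift of \<open>q\<close> is in the
  closure of the future of the lift of \<open>p\<close>, but the lift of \<open>p\<close> is not in the closure of the past
  of the lift of \<open>q\<close>.

  Writing \<open>z = a + \<i> b\<close>, the universal covering is the complex plane with projection \<open>exp\<close>. Both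
  spacetimes have a single chart and are instances of one construction \<open>null_mfd\<close>, in which the
  metric \<open>- Im (\<phi>\<^sup>2 dz\<^sup>2) / 2\<close> is given by a holomorphic 1-form \<open>\<phi> dz\<close> without zeros: \<open>dz\<close> downstairs
  and its pullback \<open>exp z dz\<close> upstairs. Every smoothness condition then reduces to
  \<open>smooth_on_Re_holomorphic\<close>.
\<close>

section \<open>The plane as the complex numbers\<close>

text \<open>
  Points of the plane are handled as complex numbers: all maps between the manifolds below are holomorphic, so smoothness,
  Jacobians and inverses of the covering map come from complex analysis.
\<close>

definition coords :: "complex \<Rightarrow> nat \<Rightarrow> real" where
  "coords z = (\<lambda>i. if i = 0 then Re z else if i = 1 then Im z else 0)"

definition point :: "(nat \<Rightarrow> real) \<Rightarrow> complex" where
  "point x = Complex (x 0) (x 1)"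

definition plane :: "(nat \<Rightarrow> real) set" where
  "plane = {x. \<forall>i\<ge>2. x i = 0}"

lemma point_coords [simp]: "point (coords z) = z"
  by (simp add: point_def coords_def)

lemma coords_0 [simp]: "coords z 0 = Re z" and coords_1 [simp]: "coords z (Suc 0) = Im z"
  by (simp_all add: coords_def)

lemma coords_in_plane [simp]: "coords z \<in> plane"
  by (simp add: coords_def plane_def)

lemma coords_point: "x \<in> plane \<Longrightarrow> coords (point x) = x"
  by (auto simp: point_def coords_def plane_def fun_eq_iff)

lemma coords_eq_iff [simp]: "coords z = coords w \<longleftrightarrow> z = w"
  by (metis point_coords)

lemma inj_coords: "inj_on coords W"
  by (simp add: inj_on_def)

lemma coords_image_iff: "x \<in> coords ` W \<longleftrightarrow> x \<in> plane \<and> point x \<in> W"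
proof
  show "x \<in> plane \<and> point x \<in> W \<Longrightarrow> x \<in> coords ` W"
    by (metis coords_point image_eqI)
qed auto

lemma coords_image_UNIV: "coords ` UNIV = plane"
  by (auto simp: coords_image_iff)

lemma continuous_on_coords [continuous_intros]:
  assumes "continuous_on A f"
  shows "continuous_on A (\<lambda>x. coords (f x))"
proof (rule continuous_on_coordinatewise_then_product)
  show "continuous_on A (\<lambda>x. coords (f x) i)" for i
    using assms by (cases "i = 0"; cases "i = 1") (auto simp: coords_def intro: continuous_intros)
qed

lemma continuous_on_point [continuous_intros]:
  assumes "continuous_on A f"
  shows "continuous_on A (\<lambda>x. point (f x))"
proof -
  have "continuous_on A (\<lambda>x. f x i)" for i
    using continuous_on_compose2[OF continuous_on_product_coordinates assms] by simp
  then show ?thesis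
    unfolding point_def Complex_eq by (intro continuous_intros)
qed

lemma Euclidean_space_2: "Euclidean_space 2 = top_of_set plane"
  by (simp add: Euclidean_space_def euclidean_product_topology plane_def)

lemma openin_coords_image:
  assumes "open W"
  shows "openin (top_of_set plane) (coords ` W)"
proof -
  have "coords ` W = plane \<inter> point -` W"
    by (auto simp: coords_image_iff)
  moreover have "continuous_on plane point"
    using continuous_on_point[OF continuous_on_id] by simp
  ultimately show ?thesis
    using assms continuous_openin_preimage_gen by metis
qed

lemma nat_less_2: "(i::nat) < 2 \<longleftrightarrow> i = 0 \<or> i = Suc 0"
  by auto

lemma sum_lessThan_2: "(\<Sum>i<2. f i) = f 0 + f (Suc 0)" for f :: "nat \<Rightarrow> real"
  by (simp add: numeral_2_eq_2)

lemma point_upd: "i < 2 \<Longrightarrow> point (x(i := t)) = point x + \<i> ^ i * of_real (t - x i)"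
  by (auto simp: nat_less_2 point_def complex_eq_iff)

section \<open>Smoothness of holomorphic functions\<close>

lemma has_partial_derivative_Re_holomorphic:
  assumes "f holomorphic_on W" "open W" "point x \<in> W" "i < 2"
  shows "((\<lambda>t. Re (f (point (x(i := t))))) has_real_derivative Re (deriv f (point x) * \<i> ^ i)) (at (x i))"
proof -
  have "((\<lambda>t. point x + \<i> ^ i * of_real (t - x i)) has_vector_derivative \<i> ^ i) (at (x i))"
    by (auto intro!: derivative_eq_intros has_vector_derivative_real_field)
  moreover have "(f has_field_derivative deriv f (point x)) (at (point x + \<i> ^ i * of_real (x i - x i)))"
    using assms by (simp add: holomorphic_derivI)
  ultimately have "((f \<circ> (\<lambda>t. point x + \<i> ^ i * of_real (t - x i))) has_vector_derivative
      \<i> ^ i * deriv f (point x)) (at (x i))"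
    by (rule field_vector_diff_chain_at)
  from bounded_linear.has_vector_derivative[OF bounded_linear_Re this]
  show ?thesis
    using assms(4) by (simp add: o_def point_upd has_real_derivative_iff_has_vector_derivative mult.commute)
qed

text \<open>
  Partial derivatives at a point of an open set thus depend only on the values in that set. This is
  needed wherever a coordinate representation agrees with a nice formula only on the image of a chart.
\<close>

lemma eventually_coordinate_line_in_open:
  assumes V: "openin (Euclidean_space n) V" and x: "x \<in> V" and i: "i < n"
  shows "\<forall>\<^sub>F t in nhds (x i). x(i := t) \<in> V"
proof -
  obtain U where U: "open U" "V = U \<inter> {x. \<forall>i\<ge>n. x i = 0}"
    using V unfolding Euclidean_space_def euclidean_product_topology
    by (auto simp: openin_subtopology)
  have "continuous_on UNIV (\<lambda>t. (x(i := t)) j)" for j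
    by (cases "j = i") auto
  then have "continuous_on UNIV (\<lambda>t. x(i := t))"
    by (rule continuous_on_coordinatewise_then_product)
  then have "open ((\<lambda>t. x(i := t)) -` U)"
    using U(1) by (simp add: open_vimage)
  then have "\<forall>\<^sub>F t in nhds (x i). t \<in> (\<lambda>t. x(i := t)) -` U"
    using x U by (intro eventually_nhds_in_open) auto
  then show ?thesis
    by eventually_elim (use x i U in auto)
qed

text \<open>
  Smoothness without computing iterated derivatives: if every partial derivative of a member of
  \<open>F\<close> is again a member of \<open>F\<close>, then by induction so are all iterated ones.
\<close>

lemma smooth_on_closed_family:
  assumes V: "openin (Euclidean_space n) V"
    and cont: "\<And>f. f \<in> F \<Longrightarrow> continuous_map (subtopology (Euclidean_space n) V) euclideanreal f"
    and partials: "\<And>f i. f \<in> F \<Longrightarrow> i < n \<Longrightarrow>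
      \<exists>g\<in>F. \<forall>x\<in>V. ((\<lambda>t. f (x(i := t))) has_real_derivative g x) (at (x i))"
    and f: "f \<in> F" and h: "\<And>x. x \<in> V \<Longrightarrow> h x = f x"
  shows "smooth_on n V h"
proof -
  have deriv_cong: "((\<lambda>t. h (x(i := t))) has_real_derivative D) (at (x i))"
    if "((\<lambda>t. g (x(i := t))) has_real_derivative D) (at (x i))" "\<And>x. x \<in> V \<Longrightarrow> h x = g x"
      "x \<in> V" "i < n" for g h :: "(nat \<Rightarrow> real) \<Rightarrow> real" and D x i
  proof -
    have "\<forall>\<^sub>F t in nhds (x i). h (x(i := t)) = g (x(i := t))"
      using eventually_coordinate_line_in_open[OF V that(3,4)] by eventually_elim (simp add: that(2))
    then show ?thesis
      using that(1) by (simp cong: DERIV_cong_ev)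
  qed
  have mem: "\<exists>g\<in>F. \<forall>x\<in>V. foldr partial_deriv is h x = g x" if "set is \<subseteq> {..<n}" for "is"
    using that
  proof (induction "is")
    case Nil
    then show ?case using f h by auto
  next
    case (Cons i js)
    then obtain g where g: "g \<in> F" "\<And>x. x \<in> V \<Longrightarrow> foldr partial_deriv js h x = g x"
      by auto
    have i: "i < n"
      using Cons.prems by simp
    obtain g' where g': "g' \<in> F"
      "\<And>x. x \<in> V \<Longrightarrow> ((\<lambda>t. g (x(i := t))) has_real_derivative g' x) (at (x i))"
      using partials[OF g(1) i] by blast
    have "foldr partial_deriv (i # js) h x = g' x" if "x \<in> V" for x
      using deriv_cong[OF g'(2)[OF that] g(2) that i]
      by (simp add: partial_deriv_def DERIV_imp_deriv del: fun_upd_apply)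
    with g'(1) show ?case by blast
  qed
  show ?thesis
    unfolding smooth_on_def
  proof (intro allI impI conjI ballI)
    fix "is" assume "set is \<subseteq> {..<n}"
    from mem[OF this] obtain g where g: "g \<in> F" "\<And>x. x \<in> V \<Longrightarrow> foldr partial_deriv is h x = g x"
      by blast
    show "continuous_map (subtopology (Euclidean_space n) V) euclideanreal (foldr partial_deriv is h)"
      by (rule continuous_map_eq[OF cont[OF g(1)]]) (simp add: g(2))
    fix x i assume x: "x \<in> V" and i: "i < n"
    show "(\<lambda>t. foldr partial_deriv is h (x(i := t))) differentiable at (x i)"
      using partials[OF g(1) i] deriv_cong[OF _ g(2) x i] x
      by (meson real_differentiable_def)
  qed
qed

text \<open>
  The real parts of holomorphic functions form such a family, because
  \<open>\<partial>\<^sub>0 Re f = Re f'\<close> and \<open>\<partial>\<^sub>1 Re f = Re (\<i> f')\<close>.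
\<close>

lemma smooth_on_Re_holomorphic:
  assumes f: "f holomorphic_on W" and W: "open W"
    and h: "\<And>x. x \<in> coords ` W \<Longrightarrow> h x = Re (f (point x))"
  shows "smooth_on 2 (coords ` W) h"
proof (rule smooth_on_closed_family[where F = "{\<lambda>x. Re (f (point x)) | f. f holomorphic_on W}"])
  show "openin (Euclidean_space 2) (coords ` W)"
    by (simp add: Euclidean_space_2 openin_coords_image W)
next
  fix g :: "(nat \<Rightarrow> real) \<Rightarrow> real"
  assume "g \<in> {\<lambda>x. Re (f (point x)) | f. f holomorphic_on W}"
  then obtain f where g: "g = (\<lambda>x. Re (f (point x)))" and f: "f holomorphic_on W"
    by blast
  have "continuous_on (coords ` W) (\<lambda>x. f (point x))"
    by (rule continuous_on_compose2[OF holomorphic_on_imp_continuous_on[OF f]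
          continuous_on_point[OF continuous_on_id]]) auto
  moreover have "plane \<inter> coords ` W = coords ` W"
    by (auto simp: coords_image_iff)
  ultimately show "continuous_map (subtopology (Euclidean_space 2) (coords ` W)) euclideanreal g"
    by (simp add: g Euclidean_space_2 subtopology_subtopology continuous_on_Re)
  fix i :: nat assume i: "i < 2"
  have "(\<lambda>z. deriv f z * \<i> ^ i) holomorphic_on W"
    by (intro holomorphic_intros f W)
  then have "(\<lambda>x. Re (deriv f (point x) * \<i> ^ i)) \<in> {\<lambda>x. Re (f (point x)) | f. f holomorphic_on W}"
    by (intro CollectI exI[of _ "\<lambda>z. deriv f z * \<i> ^ i"]) simp
  moreover have "((\<lambda>t. g (x(i := t))) has_real_derivative Re (deriv f (point x) * \<i> ^ i)) (at (x i))"
    if "x \<in> coords ` W" for x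
    using that has_partial_derivative_Re_holomorphic[OF f W _ i] unfolding g
    by (metis coords_image_iff)
  ultimately show "\<exists>g'\<in>{\<lambda>x. Re (f (point x)) | f. f holomorphic_on W}.
      \<forall>x\<in>coords ` W. ((\<lambda>t. g (x(i := t))) has_real_derivative g' x) (at (x i))"
    by (intro bexI[of _ "\<lambda>x. Re (deriv f (point x) * \<i> ^ i)"] ballI)
qed (use f h in auto)

section \<open>Plane spacetimes with prescribed null 1-forms\<close>

text \<open>
  The Lorentzian metric on \<open>W\<close> whose null directions are the kernels of the 1-forms \<open>Re (\<phi> dz)\<close>
  and \<open>Im (\<phi> dz)\<close>: it is minus their symmetric product, that is, \<open>- Im (\<phi>\<^sup>2 dz\<^sup>2) / 2\<close>. The vector
  field \<open>(1 + \<i>) / \<phi>\<close>, on which both 1-forms are 1, is declared to be future-directed. For \<open>\<phi> = 1\<close>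
  this is Minkowski space in null coordinates, and a holomorphic map \<open>f\<close> pulls the metric of \<open>\<psi>\<close> back
  to that of \<open>(\<psi> \<circ> f) f'\<close>.
\<close>

definition null_mfd :: "complex set \<Rightarrow> (complex \<Rightarrow> complex) \<Rightarrow> (nat \<Rightarrow> real) lorentz_mfd" where
  "null_mfd W \<phi> =
     \<lparr>mtop = top_of_set (coords ` W), mdim = 2, atlas = {(coords ` W, id)},
      metric = (\<lambda>c p i j. - Im ((\<phi> (point p))\<^sup>2 * \<i> ^ (i + j)) / 2),
      tfield = (\<lambda>c p. coords ((1 + \<i>) / \<phi> (point p)))\<rparr>"

lemma null_mfd_simps [simp]:
  "mtop (null_mfd W \<phi>) = top_of_set (coords ` W)"
  "mdim (null_mfd W \<phi>) = 2"
  "atlas (null_mfd W \<phi>) = {(coords ` W, id)}"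
  "metric (null_mfd W \<phi>) c p i j = - Im ((\<phi> (point p))\<^sup>2 * \<i> ^ (i + j)) / 2"
  "tfield (null_mfd W \<phi>) c p = coords ((1 + \<i>) / \<phi> (point p))"
  by (simp_all add: null_mfd_def)

lemma chart_inv_id: "x \<in> S \<Longrightarrow> chart_inv (S, id) x = x"
  unfolding chart_inv_def by (metis fst_conv id_apply inj_on_id inv_into_f_f snd_conv)

text \<open>
  Real and imaginary parts are both brought into the form required by the lemmas on real parts.
\<close>

lemma coords_eq_Re: "k < 2 \<Longrightarrow> coords w k = Re ((- \<i>) ^ k * w)"
  by (auto simp: nat_less_2)

lemma jacobian_holomorphic:
  assumes "f holomorphic_on W" "open W" and p: "p \<in> coords ` W" and "i < 2" "k < 2"
    and g: "\<And>x. x \<in> coords ` W \<Longrightarrow> g x = coords (f (point x))"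
  shows "jacobian (coords ` W, id) (S, id) g p k i = coords (deriv f (point p) * \<i> ^ i) k"
proof -
  let ?f = "\<lambda>z. (- \<i>) ^ k * f z"
  have fz: "point p \<in> W"
    using p by (auto simp: coords_image_iff)
  have "?f holomorphic_on W"
    by (intro holomorphic_intros assms)
  note D = has_partial_derivative_Re_holomorphic[OF this assms(2) fz assms(4)]
  have "\<forall>\<^sub>F t in nhds (p i). p(i := t) \<in> coords ` W"
    using assms by (intro eventually_coordinate_line_in_open[where n = 2])
      (auto simp: Euclidean_space_2 openin_coords_image)
  then have "\<forall>\<^sub>F t in nhds (p i). coord_rep (coords ` W, id) (S, id) g (p(i := t)) k =
      Re (?f (point (p(i := t))))"
    by eventually_elim (use g assms(5) in \<open>simp add: coord_rep_def chart_inv_id coords_eq_Re\<close>)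
  from DERIV_cong_ev[OF refl this refl] D
  have "((\<lambda>t. coord_rep (coords ` W, id) (S, id) g (p(i := t)) k) has_real_derivative
      Re (deriv ?f (point p) * \<i> ^ i)) (at (p i))"
    by (rule iffD2)
  moreover have "deriv ?f (point p) = (- \<i>) ^ k * deriv f (point p)"
    using assms fz by (intro deriv_cmult) (auto simp: holomorphic_on_open field_differentiable_def)
  ultimately show ?thesis
    using assms(5) unfolding jacobian_def partial_deriv_def
    by (simp add: coords_eq_Re DERIV_imp_deriv mult.assoc del: fun_upd_apply)
qed

lemma gprod_null_mfd:
  "gprod (null_mfd W \<phi>) c p v w = - Im ((\<phi> (point p))\<^sup>2 * point v * point w) / 2"
  unfolding gprod_def
  by (simp add: sum_lessThan_2 point_def Complex_eq) (simp add: field_simps)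

lemma pushforward_holomorphic:
  assumes "f holomorphic_on W" "open W" "p \<in> coords ` W" "k < 2"
    and "\<And>x. x \<in> coords ` W \<Longrightarrow> g x = coords (f (point x))"
  shows "pushforward (null_mfd W \<phi>) (coords ` W, id) (S, id) g p v k =
    coords (deriv f (point p) * point v) k"
  unfolding pushforward_def using assms(4)
  by (simp add: sum_lessThan_2 jacobian_holomorphic[OF assms(1,2,3) _ _ assms(5)] nat_less_2)
    (auto simp: point_def)

text \<open>
  The columns of the Jacobian are \<open>f'\<close> and \<open>\<i> f'\<close>, so a component of the pullback is a value of the
  bilinear form \<open>- Im (\<psi>\<^sup>2 v w) / 2\<close>, in which the two factors \<open>f'\<close> combine with \<open>\<psi>\<^sup>2\<close>.
\<close>

lemma pullback_metric_holomorphic: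
  assumes "f holomorphic_on W" "open W" "p \<in> coords ` W" "i < 2" "j < 2"
    and g: "\<And>x. x \<in> coords ` W \<Longrightarrow> g x = coords (f (point x))"
    and \<phi>: "\<phi> (point p) = \<psi> (f (point p)) * deriv f (point p)"
  shows "pullback_metric (null_mfd W' \<psi>) (coords ` W, id) (S, id) g p i j =
    metric (null_mfd W \<phi>) c p i j"
proof -
  let ?v = "\<lambda>i. coords (deriv f (point p) * \<i> ^ i)"
  have "pullback_metric (null_mfd W' \<psi>) (coords ` W, id) (S, id) g p i j =
      gprod (null_mfd W' \<psi>) undefined (g p) (?v i) (?v j)"
    unfolding pullback_metric_def gprod_def
    by (intro sum.cong refl) (simp_all add: jacobian_holomorphic[OF assms(1-3) _ _ g] assms(4,5))
  then show ?thesis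
    by (simp add: gprod_null_mfd g[OF assms(3)] \<phi> power_mult_distrib power_add power2_eq_square
        mult_ac del: Im_complex_of_real times_complex.simps)
qed

lemma smooth_map_on_holomorphic:
  assumes f: "f holomorphic_on U" and U: "open U" "U \<subseteq> W" and "f ` U \<subseteq> W'"
    and g: "\<And>x. x \<in> coords ` U \<Longrightarrow> g x = coords (f (point x))"
  shows "smooth_map_on (null_mfd W \<phi>) (coords ` U) (null_mfd W' \<psi>) g"
proof -
  have maps: "g x \<in> coords ` W'" if "x \<in> coords ` U" for x
    using that assms(4) g[OF that] by (auto simp: coords_image_iff)
  have "continuous_on (coords ` U) (\<lambda>x. coords (f (point x)))"
    by (intro continuous_on_coords continuous_on_compose2[OF holomorphic_on_imp_continuous_on[OF f]
          continuous_on_point[OF continuous_on_id]]) auto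
  then have cont: "continuous_on (coords ` U) g"
    using g by (metis (no_types, lifting) continuous_on_cong)
  have sub: "coords ` W \<inter> coords ` U = coords ` U"
    using U by auto
  have "smooth_on 2 (coords ` U) (\<lambda>x. coord_rep (coords ` W, id) (coords ` W', id) g x k)"
    if "k < 2" for k
  proof (rule smooth_on_Re_holomorphic)
    show "(\<lambda>z. (- \<i>) ^ k * f z) holomorphic_on U"
      by (intro holomorphic_intros f)
    show "coord_rep (coords ` W, id) (coords ` W', id) g x k = Re ((- \<i>) ^ k * f (point x))"
      if "x \<in> coords ` U" for x
    proof -
      have "x \<in> coords ` W"
        using that U(2) by auto
      then show ?thesis
        using that \<open>k < 2\<close> by (simp add: coord_rep_def chart_inv_id g coords_eq_Re)
    qed
  qed (rule U)
  moreover have "coords ` W \<inter> coords ` U \<inter> g -` (coords ` W') = coords ` U"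
    using sub maps by blast
  ultimately show ?thesis
    using cont maps
    by (auto simp: smooth_map_on_def subtopology_subtopology sub continuous_map_in_subtopology)
qed

lemma second_countable_euclidean:
  "second_countable (euclidean :: 'a::second_countable_topology topology)"
proof -
  obtain B :: "'a set set" where B: "countable B" "topological_basis B"
    using ex_countable_basis by blast
  have "\<exists>V\<in>B. x \<in> V \<and> V \<subseteq> U" if "open U" "x \<in> U" for U x
    using topological_basisE[OF B(2) that] by metis
  then show ?thesis
    unfolding second_countable_def using B topological_basis_open[OF B(2)]
    by (intro exI[of _ B]) (simp flip: open_openin)
qed

lemma smooth_manifold_null_mfd:
  assumes "open W"
  shows "smooth_manifold (null_mfd W \<phi>)"
proof -
  have "is_chart (null_mfd W \<phi>) (coords ` W, id)"
    using assms coords_in_plane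
    by (auto simp: is_chart_def Euclidean_space_2 openin_coords_image subtopology_subtopology
        Int_absorb1 image_subset_iff)
  moreover have "smooth_map_on (null_mfd W \<phi>) (coords ` W) (null_mfd W \<phi>) id"
    by (rule smooth_map_on_holomorphic[where f = id])
      (use assms in \<open>auto simp: coords_image_iff coords_point\<close>)
  ultimately show ?thesis
    by (auto simp: smooth_manifold_def smooth_map_on_def Hausdorff_space_subtopology
        second_countable_subtopology second_countable_euclidean)
qed

text \<open>
  The vectors \<open>(1 \<plusminus> \<i>) / \<phi>\<close> form an orthonormal basis, since \<open>(1 \<plusminus> \<i>)\<^sup>2 = \<plusminus>2\<i>\<close> and
  \<open>(1 + \<i>) (1 - \<i>)\<close> is real.
\<close>

lemma lorentzian_metric_null_mfd:
  assumes "open W" "\<phi> holomorphic_on W" "\<And>z. z \<in> W \<Longrightarrow> \<phi> z \<noteq> 0"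
  shows "lorentzian_metric (null_mfd W \<phi>)"
proof -
  let ?M = "null_mfd W \<phi>"
  have "lorentzian_form 2 (metric ?M c p)" if p: "p \<in> coords ` W" for c p
  proof -
    have nz: "\<phi> (point p) \<noteq> 0"
      using p assms(3) by auto
    let ?e = "\<lambda>a::nat. coords ((if a = 0 then 1 + \<i> else 1 - \<i>) / \<phi> (point p))"
    have "(\<Sum>i<2. \<Sum>j<2. metric ?M c p i j * ?e a i * ?e b j) =
        (if a \<noteq> b then 0 else if a = 0 then - 1 else 1)" if "a < 2" "b < 2" for a b
    proof -
      have "(\<Sum>i<2. \<Sum>j<2. metric ?M c p i j * ?e a i * ?e b j) = gprod ?M c p (?e a) (?e b)"
        by (simp add: gprod_def)
      also have "\<dots> = - Im ((if a = 0 then 1 + \<i> else 1 - \<i>) * (if b = 0 then 1 + \<i> else 1 - \<i>)) / 2"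
        using nz by (simp add: gprod_null_mfd power2_eq_square field_simps)
      finally show ?thesis
        using that by (auto simp: nat_less_2)
    qed
    then show ?thesis
      unfolding lorentzian_form_def by (intro conjI exI[of _ ?e]) (auto simp: add.commute)
  qed
  moreover have "smooth_on 2 (coords ` W) (\<lambda>x. metric ?M c (chart_inv (coords ` W, id) x) i j)" for c i j
    by (rule smooth_on_Re_holomorphic[where f = "\<lambda>z. \<i> * (\<phi> z)\<^sup>2 * \<i> ^ (i + j) / 2"])
      (use assms in \<open>auto intro!: holomorphic_intros simp: chart_inv_id simp del: image_iff\<close>)
  moreover have "metric ?M c p i j = pullback_metric ?M (coords ` W, id) (coords ` W, id) id p i j"
    if "p \<in> coords ` W" "i < 2" "j < 2" for p c i j
    by (rule pullback_metric_holomorphic[where f = id, symmetric])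
      (use that assms in \<open>auto simp: coords_image_iff coords_point\<close>)
  ultimately show ?thesis
    unfolding lorentzian_metric_def by auto
qed

lemma time_orientation_null_mfd:
  assumes "open W" "\<phi> holomorphic_on W" "\<And>z. z \<in> W \<Longrightarrow> \<phi> z \<noteq> 0"
  shows "time_orientation (null_mfd W \<phi>)"
proof -
  have timelike: "gprod (null_mfd W \<phi>) c p (tfield (null_mfd W \<phi>) c p) (tfield (null_mfd W \<phi>) c p) < 0"
    if "p \<in> coords ` W" for c p
    using that assms(3)[of "point p"] by (auto simp: gprod_null_mfd power2_eq_square field_simps)
  have continuous: "continuous_on (coords ` W) (\<lambda>p. tfield (null_mfd W \<phi>) c p i)" for c i
  proof -
    have "continuous_on (coords ` W) (\<lambda>p. \<phi> (point p))"
      by (intro continuous_on_compose2[OF holomorphic_on_imp_continuous_on[OF assms(2)]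
            continuous_on_point[OF continuous_on_id]]) auto
    then have "continuous_on (coords ` W) (tfield (null_mfd W \<phi>) c)"
      unfolding null_mfd_simps using assms(3)
      by (intro continuous_on_coords continuous_intros) auto
    then show ?thesis
      by (rule continuous_on_product_then_coordinatewise)
  qed
  have transforms: "tfield (null_mfd W \<phi>) d p k =
      pushforward (null_mfd W \<phi>) (coords ` W, id) (coords ` W, id) id p (tfield (null_mfd W \<phi>) c p) k"
    if "p \<in> coords ` W" "k < 2" for c d p k
    by (subst pushforward_holomorphic[where f = id])
      (use that assms in \<open>auto simp: coords_image_iff coords_point\<close>)
  show ?thesis
    unfolding time_orientation_def
  proof (intro conjI ballI allI impI)
    show "gprod (null_mfd W \<phi>) c p (tfield (null_mfd W \<phi>) c p) (tfield (null_mfd W \<phi>) c p) < 0"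
      if "c \<in> atlas (null_mfd W \<phi>)" "p \<in> chart_dom c" for c p
      using that by (intro timelike) simp
    show "continuous_map (subtopology (mtop (null_mfd W \<phi>)) (chart_dom c)) euclideanreal
        (\<lambda>p. tfield (null_mfd W \<phi>) c p i)"
      if "c \<in> atlas (null_mfd W \<phi>)" for c i
      using that continuous[of c i] by (simp add: subtopology_subtopology)
    show "tfield (null_mfd W \<phi>) d p k = pushforward (null_mfd W \<phi>) c d id p (tfield (null_mfd W \<phi>) c p) k"
      if "c \<in> atlas (null_mfd W \<phi>)" "d \<in> atlas (null_mfd W \<phi>)" "p \<in> chart_dom c \<inter> chart_dom d"
        "k < mdim (null_mfd W \<phi>)" for c d p k
      using transforms[of p k d c] that by simp
  qed
qed

lemma spacetime_null_mfd:
  assumes "open W" "connected W" "W \<noteq> {}" "\<phi> holomorphic_on W" "\<And>z. z \<in> W \<Longrightarrow> \<phi> z \<noteq> 0"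
  shows "spacetime (null_mfd W \<phi>)"
proof -
  have "connected (coords ` W)"
    using assms(2) by (intro connected_continuous_image continuous_on_coords continuous_on_id)
  then have "connected_space (top_of_set (coords ` W))"
    by (metis connectedin_def connectedin_iff_connected)
  then show ?thesis
    using assms smooth_manifold_null_mfd lorentzian_metric_null_mfd time_orientation_null_mfd
    by (simp add: spacetime_def)
qed

section \<open>Timelike curves in null coordinates\<close>

text \<open>
  The sign \<open>\<sigma> = 1\<close> stands for the future and \<open>\<sigma> = - 1\<close> for the past, so that each argument about
  one time direction also covers the other.
\<close>

definition oriented_timelike ::
    "real \<Rightarrow> (nat \<Rightarrow> real) lorentz_mfd \<Rightarrow> (nat \<Rightarrow> real) chart \<Rightarrow> (nat \<Rightarrow> real) \<Rightarrow> (nat \<Rightarrow> real) \<Rightarrow> bool"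
  where "oriented_timelike \<sigma> M c p v \<longleftrightarrow> gprod M c p v v < 0 \<and> \<sigma> * gprod M c p v (tfield M c p) < 0"

definition chron :: "real \<Rightarrow> (nat \<Rightarrow> real) lorentz_mfd \<Rightarrow> (nat \<Rightarrow> real) \<Rightarrow> (nat \<Rightarrow> real) set" where
  "chron \<sigma> M p = {q. \<exists>\<gamma> a b. timelike_curve (oriented_timelike \<sigma>) M \<gamma> a b \<and> \<gamma> a = p \<and> \<gamma> b = q}"

lemma future_timelike_eq: "future_timelike = oriented_timelike 1"
  by (simp add: fun_eq_iff future_timelike_def oriented_timelike_def)

lemma past_timelike_eq: "past_timelike = oriented_timelike (- 1)"
  by (simp add: fun_eq_iff past_timelike_def oriented_timelike_def)

lemma chron_future_eq: "chron_future = chron 1"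
  by (simp add: fun_eq_iff chron_future_def chron_def future_timelike_eq)

lemma chron_past_eq: "chron_past = chron (- 1)"
  by (simp add: fun_eq_iff chron_past_def chron_def past_timelike_eq)

text \<open>
  With \<open>w = \<phi> v\<close> the two products are \<open>- Re w Im w\<close> and \<open>- (Re w + Im w) / 2\<close>: the first says that
  \<open>w\<close> lies in the first or the third open quadrant, the second selects one of them.
\<close>

lemma oriented_timelike_null_mfd:
  assumes "\<sigma> = 1 \<or> \<sigma> = - 1" and nz: "\<phi> (point p) \<noteq> 0"
  shows "oriented_timelike \<sigma> (null_mfd W \<phi>) c p v \<longleftrightarrow>
    0 < \<sigma> * Re (\<phi> (point p) * point v) \<and> 0 < \<sigma> * Im (\<phi> (point p) * point v)"
proof -
  let ?M = "null_mfd W \<phi>"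
  define w where "w = \<phi> (point p) * point v"
  have "gprod ?M c p v v = - Im (w * w) / 2"
    by (simp only: gprod_null_mfd w_def power2_eq_square mult_ac)
  then have vv: "gprod ?M c p v v = - (Re w * Im w)"
    by simp
  have "(\<phi> (point p))\<^sup>2 * point v * point (tfield ?M c p) = w * (1 + \<i>)"
    using nz by (simp add: w_def power2_eq_square)
  then have "gprod ?M c p v (tfield ?M c p) = - Im (w * (1 + \<i>)) / 2"
    by (simp only: gprod_null_mfd)
  then have vt: "gprod ?M c p v (tfield ?M c p) = - (Re w + Im w) / 2"
    by simp
  show ?thesis
    using assms(1) unfolding oriented_timelike_def vv vt w_def[symmetric]
    by (auto simp: zero_less_mult_iff)
qed

definition timelike_arc ::
    "real \<Rightarrow> complex set \<Rightarrow> (complex \<Rightarrow> complex) \<Rightarrow> (real \<Rightarrow> complex) \<Rightarrow> real \<Rightarrow> real \<Rightarrow> bool" where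
  "timelike_arc \<sigma> W \<phi> \<zeta> a b \<longleftrightarrow> a < b \<and>
     (\<exists>\<zeta>'. continuous_on {a..b} \<zeta>' \<and>
       (\<forall>t\<in>{a..b}. \<zeta> t \<in> W \<and> (\<zeta> has_vector_derivative \<zeta>' t) (at t within {a..b}) \<and>
          0 < \<sigma> * Re (\<phi> (\<zeta> t) * \<zeta>' t) \<and> 0 < \<sigma> * Im (\<phi> (\<zeta> t) * \<zeta>' t)))"

lemma bounded_linear_coords: "bounded_linear (\<lambda>z. coords z i)"
  by (cases "i = 0"; cases "i = 1")
    (auto simp: coords_def bounded_linear_Re bounded_linear_Im)

lemma timelike_curve_null_mfdI:
  assumes \<sigma>: "\<sigma> = 1 \<or> \<sigma> = - 1" and nz: "\<And>z. z \<in> W \<Longrightarrow> \<phi> z \<noteq> 0"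
    and arc: "timelike_arc \<sigma> W \<phi> \<zeta> a b"
  shows "timelike_curve (oriented_timelike \<sigma>) (null_mfd W \<phi>) (\<lambda>t. coords (\<zeta> t)) a b"
proof -
  obtain \<zeta>' where ab: "a < b" and cont: "continuous_on {a..b} \<zeta>'"
    and W: "\<And>t. t \<in> {a..b} \<Longrightarrow> \<zeta> t \<in> W"
    and D: "\<And>t. t \<in> {a..b} \<Longrightarrow> (\<zeta> has_vector_derivative \<zeta>' t) (at t within {a..b})"
    and pos: "\<And>t. t \<in> {a..b} \<Longrightarrow> 0 < \<sigma> * Re (\<phi> (\<zeta> t) * \<zeta>' t) \<and> 0 < \<sigma> * Im (\<phi> (\<zeta> t) * \<zeta>' t)"
    using arc unfolding timelike_arc_def by blast
  let ?\<gamma> = "\<lambda>t. coords (\<zeta> t)" and ?c = "(coords ` W, id) :: (nat \<Rightarrow> real) chart"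
  have D_coords: "((\<lambda>t. coords (\<zeta> t) i) has_vector_derivative coords (\<zeta>' t) i) (at t within {a..b})"
    if "t \<in> {a..b}" for t i
    by (rule bounded_linear.has_vector_derivative[OF bounded_linear_coords D[OF that]])
  then have vel: "velocity ?c ?\<gamma> a b t = coords (\<zeta>' t)" if "t \<in> {a..b}" for t
    unfolding velocity_def using that ab D_coords
    by (intro ext vector_derivative_within_closed_interval) auto
  have "continuous_on {a..b} \<zeta>"
    using D by (meson continuous_on_eq_continuous_within has_vector_derivative_continuous)
  then have "continuous_on {a..b} ?\<gamma>"
    by (rule continuous_on_coords)
  moreover have "continuous_on {t \<in> {a..b}. ?\<gamma> t \<in> coords ` W} (\<lambda>t. velocity ?c ?\<gamma> a b t i)" for i
  proof -
    have "continuous_on {a..b} (\<lambda>t. coords (\<zeta>' t) i)"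
      by (rule continuous_on_product_then_coordinatewise[OF continuous_on_coords[OF cont]])
    then have "continuous_on {a..b} (\<lambda>t. velocity ?c ?\<gamma> a b t i)"
      by (subst continuous_on_cong[OF refl]) (simp_all add: vel)
    then show ?thesis
      by (rule continuous_on_subset) auto
  qed
  ultimately have "C1_curve (null_mfd W \<phi>) ?\<gamma> a b"
    using W differentiableI_vector[OF D_coords] unfolding C1_curve_def
    by (auto simp: continuous_map_in_subtopology)
  moreover have "oriented_timelike \<sigma> (null_mfd W \<phi>) c (?\<gamma> t) (velocity ?c ?\<gamma> a b t)"
    if "t \<in> {a..b}" for c t
    using pos[OF that] nz[OF W[OF that]] by (simp add: oriented_timelike_null_mfd[OF \<sigma>] vel[OF that])
  ultimately show ?thesis
    using ab unfolding timelike_curve_def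
    by (intro exI[of _ "1::nat"] exI[of _ "\<lambda>k. if k = 0 then a else b"]) simp
qed

lemma timelike_arc_of_C1_curve:
  assumes \<sigma>: "\<sigma> = 1 \<or> \<sigma> = - 1" and nz: "\<And>z. z \<in> W \<Longrightarrow> \<phi> z \<noteq> 0"
    and ab: "a < b" and C1: "C1_curve (null_mfd W \<phi>) \<gamma> a b"
    and timelike: "\<And>t. t \<in> {a..b} \<Longrightarrow> oriented_timelike \<sigma> (null_mfd W \<phi>) (coords ` W, id) (\<gamma> t)
      (velocity (coords ` W, id) \<gamma> a b t)"
  shows "timelike_arc \<sigma> W \<phi> (\<lambda>t. point (\<gamma> t)) a b"
proof -
  let ?v = "\<lambda>t. velocity (coords ` W, id) \<gamma> a b t"
  have in_W: "\<gamma> t \<in> coords ` W" if "t \<in> {a..b}" for t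
    using C1 that by (auto simp: C1_curve_def continuous_map_in_subtopology)
  then have set_eq: "{t \<in> {a..b}. \<gamma> t \<in> coords ` W} = {a..b}"
    by blast
  have D: "((\<lambda>t. \<gamma> t i) has_vector_derivative ?v t i) (at t within {a..b})"
    if "t \<in> {a..b}" "i < 2" for t i
    using C1 that in_W[OF that(1)] unfolding C1_curve_def velocity_def
    by (simp add: vector_derivative_works)
  have cont: "continuous_on {a..b} (\<lambda>t. ?v t i)" if "i < 2" for i
  proof -
    have "continuous_on {t \<in> {a..b}. \<gamma> t \<in> coords ` W} (\<lambda>t. ?v t i)"
      using C1 that by (simp add: C1_curve_def)
    then show ?thesis
      unfolding set_eq .
  qed
  have "((\<lambda>t. point (\<gamma> t)) has_vector_derivative point (?v t)) (at t within {a..b})"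
    if "t \<in> {a..b}" for t
    using D[OF that, of 0] D[OF that, of 1]
    by (simp add: point_def has_vector_derivative_complex_iff has_real_derivative_iff_has_vector_derivative)
  moreover have "continuous_on {a..b} (\<lambda>t. point (?v t))"
    using cont[of 0] cont[of 1]
    by (auto simp: point_def Complex_eq intro!: continuous_intros)
  moreover have "point (\<gamma> t) \<in> W" if "t \<in> {a..b}" for t
    using in_W[OF that] by (auto simp: coords_image_iff)
  moreover have "0 < \<sigma> * Re (\<phi> (point (\<gamma> t)) * point (?v t)) \<and>
      0 < \<sigma> * Im (\<phi> (point (\<gamma> t)) * point (?v t))" if "t \<in> {a..b}" for t
    using timelike[OF that] nz calculation(3)[OF that] oriented_timelike_null_mfd[OF \<sigma>] by blast
  ultimately show ?thesis
    unfolding timelike_arc_def using ab by blast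
qed

text \<open>
  A piecewise \<open>C\<^sup>1\<close> curve has at least one piece, so a transitive relation between the ends of every
  single arc passes to the ends of the curve, without being reflexive. It will be
  strict increase of null coordinates in one application and preservation of a region in another.
\<close>

lemma chron_imp_transp:
  assumes \<sigma>: "\<sigma> = 1 \<or> \<sigma> = - 1" and nz: "\<And>z. z \<in> W \<Longrightarrow> \<phi> z \<noteq> 0"
    and q: "q \<in> chron \<sigma> (null_mfd W \<phi>) p"
    and R: "transp R" "\<And>\<zeta> a b. timelike_arc \<sigma> W \<phi> \<zeta> a b \<Longrightarrow> R (\<zeta> a) (\<zeta> b)"
  shows "q \<in> coords ` W" "R (point p) (point q)"
proof -
  obtain \<gamma> m and s :: "nat \<Rightarrow> real" where m: "0 < m" and ends: "\<gamma> (s 0) = p" "\<gamma> (s m) = q"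
    and pieces: "\<And>k. k < m \<Longrightarrow> s k < s (Suc k) \<and> C1_curve (null_mfd W \<phi>) \<gamma> (s k) (s (Suc k)) \<and>
      (\<forall>t\<in>{s k..s (Suc k)}. \<gamma> t \<in> coords ` W \<longrightarrow> oriented_timelike \<sigma> (null_mfd W \<phi>) (coords ` W, id)
        (\<gamma> t) (velocity (coords ` W, id) \<gamma> (s k) (s (Suc k)) t))"
    using q unfolding chron_def timelike_curve_def by auto
  have in_W: "\<gamma> t \<in> coords ` W" if "k < m" "t \<in> {s k..s (Suc k)}" for k t
    using pieces[OF that(1)] that(2) by (auto simp: C1_curve_def continuous_map_in_subtopology)
  have "timelike_arc \<sigma> W \<phi> (\<lambda>t. point (\<gamma> t)) (s k) (s (Suc k))" if "k < m" for k
    using pieces[OF that] in_W[OF that] by (intro timelike_arc_of_C1_curve[OF \<sigma> nz]) auto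
  then have step: "R (point (\<gamma> (s k))) (point (\<gamma> (s (Suc k))))" if "k < m" for k
    using R(2) that by blast
  have "R (point (\<gamma> (s 0))) (point (\<gamma> (s (Suc k))))" if "k < m" for k
    using that
  proof (induction k)
    case (Suc k)
    then show ?case
      using step[of "Suc k"] R(1) by (meson Suc_lessD transpD)
  qed (rule step)
  from this[of "m - 1"] in_W[of "m - 1" "s m"] pieces[of "m - 1"] m ends
  show "q \<in> coords ` W" "R (point p) (point q)"
    by simp_all
qed

lemma chron_subset:
  assumes "\<sigma> = 1 \<or> \<sigma> = - 1" and "\<And>z. z \<in> W \<Longrightarrow> \<phi> z \<noteq> 0"
  shows "chron \<sigma> (null_mfd W \<phi>) p \<subseteq> coords ` W"
proof
  show "q \<in> coords ` W" if "q \<in> chron \<sigma> (null_mfd W \<phi>) p" for q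
    by (rule chron_imp_transp(1)[where R = "\<lambda>_ _. True", OF assms that]) (auto intro: transpI)
qed

lemma timelike_arc_subset:
  assumes "timelike_arc \<sigma> W \<phi> \<zeta> a b" "a < t" "t \<le> b"
  shows "timelike_arc \<sigma> W \<phi> \<zeta> a t"
proof -
  have sub: "{a..t} \<subseteq> {a..b}"
    using assms by auto
  obtain \<zeta>' where "continuous_on {a..b} \<zeta>'" "\<forall>t\<in>{a..b}. \<zeta> t \<in> W \<and>
      (\<zeta> has_vector_derivative \<zeta>' t) (at t within {a..b}) \<and>
      0 < \<sigma> * Re (\<phi> (\<zeta> t) * \<zeta>' t) \<and> 0 < \<sigma> * Im (\<phi> (\<zeta> t) * \<zeta>' t)"
    using assms(1) unfolding timelike_arc_def by blast
  then show ?thesis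
    unfolding timelike_arc_def using assms(2) sub
    by (intro conjI exI[of _ \<zeta>'])
      (auto intro: continuous_on_subset has_vector_derivative_within_subset[OF _ sub])
qed

text \<open>
  A primitive \<open>\<Phi>\<close> of \<open>\<phi>\<close> provides the null coordinates \<open>Re \<Phi>\<close> and \<open>Im \<Phi>\<close>: their derivatives along
  an arc are the two quantities whose sign makes the arc timelike.
\<close>

lemma null_coordinates_increase:
  assumes arc: "timelike_arc \<sigma> W \<phi> \<zeta> a b"
    and \<Phi>: "\<And>z. z \<in> W \<Longrightarrow> (\<Phi> has_field_derivative \<phi> z) (at z)"
  shows "\<sigma> * Re (\<Phi> (\<zeta> a)) < \<sigma> * Re (\<Phi> (\<zeta> b))" "\<sigma> * Im (\<Phi> (\<zeta> a)) < \<sigma> * Im (\<Phi> (\<zeta> b))"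
proof -
  obtain \<zeta>' where ab: "a < b"
    and W: "\<And>t. t \<in> {a..b} \<Longrightarrow> \<zeta> t \<in> W"
    and D: "\<And>t. t \<in> {a..b} \<Longrightarrow> (\<zeta> has_vector_derivative \<zeta>' t) (at t within {a..b})"
    and pos: "\<And>t. t \<in> {a..b} \<Longrightarrow> 0 < \<sigma> * Re (\<phi> (\<zeta> t) * \<zeta>' t) \<and> 0 < \<sigma> * Im (\<phi> (\<zeta> t) * \<zeta>' t)"
    using arc unfolding timelike_arc_def by blast
  have D\<Phi>: "((\<Phi> \<circ> \<zeta>) has_vector_derivative \<zeta>' t * \<phi> (\<zeta> t)) (at t within {a..b})" if "t \<in> {a..b}" for t
    using \<Phi>[OF W[OF that]] by (intro field_vector_diff_chain_within D that) (rule has_field_derivative_at_within)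
  have incr: "\<sigma> * h (\<Phi> (\<zeta> a)) < \<sigma> * h (\<Phi> (\<zeta> b))"
    if h: "bounded_linear h" and h_pos: "\<And>t. t \<in> {a..b} \<Longrightarrow> 0 < \<sigma> * h (\<zeta>' t * \<phi> (\<zeta> t))"
    for h :: "complex \<Rightarrow> real"
  proof -
    have Dh: "((\<lambda>t. \<sigma> * h (\<Phi> (\<zeta> t))) has_real_derivative \<sigma> * h (\<zeta>' t * \<phi> (\<zeta> t))) (at t within {a..b})"
      if "t \<in> {a..b}" for t
      using bounded_linear.has_vector_derivative[OF h D\<Phi>[OF that]]
      by (simp add: has_real_derivative_iff_has_vector_derivative has_vector_derivative_mult_right)
    show ?thesis
    proof (rule DERIV_pos_imp_increasing_open[OF ab])
      show "\<exists>y. ((\<lambda>t. \<sigma> * h (\<Phi> (\<zeta> t))) has_real_derivative y) (at t) \<and> 0 < y" if "a < t" "t < b" for t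
        using Dh[of t] h_pos[of t] that by (auto simp: at_within_Icc_at)
      show "continuous_on {a..b} (\<lambda>t. \<sigma> * h (\<Phi> (\<zeta> t)))"
        using Dh by (meson DERIV_continuous continuous_on_eq_continuous_within)
    qed
  qed
  show "\<sigma> * Re (\<Phi> (\<zeta> a)) < \<sigma> * Re (\<Phi> (\<zeta> b))" "\<sigma> * Im (\<Phi> (\<zeta> a)) < \<sigma> * Im (\<Phi> (\<zeta> b))"
    using pos by (auto intro!: incr bounded_linear_Re bounded_linear_Im simp: mult.commute)
qed

section \<open>The punctured Minkowski plane is causally continuous\<close>

abbreviation punctured :: "(nat \<Rightarrow> real) lorentz_mfd" where
  "punctured \<equiv> null_mfd (- {0}) (\<lambda>_. 1)"

abbreviation cover :: "(nat \<Rightarrow> real) lorentz_mfd" where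
  "cover \<equiv> null_mfd UNIV exp"

abbreviation cover_map :: "(nat \<Rightarrow> real) \<Rightarrow> nat \<Rightarrow> real" where
  "cover_map x \<equiv> coords (exp (point x))"

lemma closure_of_null_mfd:
  assumes "T \<subseteq> coords ` W"
  shows "mtop (null_mfd W \<phi>) closure_of T = coords ` W \<inter> closure T"
  using assms by (simp add: closure_of_subtopology Int_absorb1)

text \<open>
  Removing the origin costs nothing: between any two points of the open order relation run at least
  two curves that have no inner point in common.
\<close>

lemma chron_punctured:
  assumes \<sigma>: "\<sigma> = 1 \<or> \<sigma> = - 1" and "z0 \<noteq> 0" "z \<noteq> 0"
  shows "coords z \<in> chron \<sigma> punctured (coords z0) \<longleftrightarrow> 0 < \<sigma> * Re (z - z0) \<and> 0 < \<sigma> * Im (z - z0)"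
proof
  let ?R = "\<lambda>z w. \<sigma> * Re z < \<sigma> * Re w \<and> \<sigma> * Im z < \<sigma> * Im w"
  assume "coords z \<in> chron \<sigma> punctured (coords z0)"
  then have "?R (point (coords z0)) (point (coords z))"
  proof (rule chron_imp_transp(2)[OF \<sigma>, rotated])
    show "transp ?R"
      by (auto intro!: transpI)
    show "?R (\<zeta> a) (\<zeta> b)" if "timelike_arc \<sigma> (- {0}) (\<lambda>_. 1) \<zeta> a b" for \<zeta> a b
      using null_coordinates_increase[OF that, of id] by (auto simp: id_def)
  qed simp
  then show "0 < \<sigma> * Re (z - z0) \<and> 0 < \<sigma> * Im (z - z0)"
    by (simp add: right_diff_distrib)
next
  define A B where "A = Re (z - z0)" and "B = Im (z - z0)"
  assume "0 < \<sigma> * Re (z - z0) \<and> 0 < \<sigma> * Im (z - z0)"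
  then have A: "0 < \<sigma> * A" and B: "0 < \<sigma> * B"
    by (simp_all add: A_def B_def)
  define t0 where "t0 = - Re z0 / A"
  define h where "h c t = Im z0 + B * (t + c * t * (1 - t))" for c t :: real
  have nz: "A \<noteq> 0" "B \<noteq> 0"
    using A B by auto
  \<comment> \<open>The first null coordinate vanishes only at time \<open>t0\<close>. The line (\<open>c = 0\<close>) and the parabola
    (\<open>c = 1 / 2\<close>) differ at all inner times, so one of them misses the origin at time \<open>t0\<close>.\<close>
  obtain c where c: "c = 0 \<or> c = 1 / 2" and avoids: "t0 = 0 \<or> t0 = 1 \<or> h c t0 \<noteq> 0"
  proof (cases "h 0 t0 = 0")
    case True
    then have "h (1 / 2) t0 = B * t0 * (1 - t0) / 2"
      by (simp add: h_def field_simps)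
    then show ?thesis
      using nz by (intro that[of "1 / 2"]) auto
  qed (use that in blast)
  define \<zeta> where "\<zeta> t = Complex (Re z0 + A * t) (h c t)" for t
  define \<zeta>' where "\<zeta>' t = Complex A (B * (1 + c * (1 - 2 * t)))" for t
  have ends: "\<zeta> 0 = z0" "\<zeta> 1 = z"
    by (simp_all add: \<zeta>_def h_def A_def B_def complex_eq_iff)
  have "timelike_arc \<sigma> (- {0}) (\<lambda>_. 1) \<zeta> 0 1"
    unfolding timelike_arc_def
  proof (intro conjI exI[of _ \<zeta>'] ballI)
    show "continuous_on {0..1} \<zeta>'"
      unfolding \<zeta>'_def Complex_eq by (intro continuous_intros)
    fix t :: real assume t: "t \<in> {0..1}"
    show "\<zeta> t \<in> - {0}"
    proof
      assume "\<zeta> t \<in> {0}"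
      then have zero: "Re z0 + A * t = 0" "h c t = 0"
        by (auto simp: \<zeta>_def complex_eq_iff)
      then have "t = t0"
        using nz by (simp add: t0_def field_simps)
      then show False
        using avoids zero ends assms(2,3) \<open>\<zeta> t \<in> {0}\<close> by auto
    qed
    show "(\<zeta> has_vector_derivative \<zeta>' t) (at t within {0..1})"
      unfolding \<zeta>_def \<zeta>'_def h_def
      by (auto simp: has_vector_derivative_complex_iff algebra_simps intro!: derivative_eq_intros)
    have "- 1 \<le> 1 - 2 * t" "1 - 2 * t \<le> 1"
      using t by auto
    then have "0 < 1 + c * (1 - 2 * t)"
      using c by (elim disjE; hypsubst) (use t in \<open>simp_all add: field_simps\<close>)
    then have "0 < \<sigma> * B * (1 + c * (1 - 2 * t))"
      using B by (rule mult_pos_pos[rotated])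
    then show "0 < \<sigma> * Re (1 * \<zeta>' t)" "0 < \<sigma> * Im (1 * \<zeta>' t)"
      using A by (simp_all add: \<zeta>'_def mult.assoc)
  qed simp
  from timelike_curve_null_mfdI[OF \<sigma> _ this] ends
  show "coords z \<in> chron \<sigma> punctured (coords z0)"
    unfolding chron_def by (auto intro!: exI[of _ "\<lambda>t. coords (\<zeta> t)"])
qed

text \<open>
  This description is symmetric in the two points up to the sign of \<open>\<sigma>\<close>, which is what makes the spacetime reflecting, and it recovers the vertex of the cone, which
  makes it distinguishing.
\<close>

lemma closure_chron_punctured:
  assumes \<sigma>: "\<sigma> = 1 \<or> \<sigma> = - 1" and nz: "z0 \<noteq> 0" "z \<noteq> 0"
  shows "coords z \<in> mtop punctured closure_of chron \<sigma> punctured (coords z0) \<longleftrightarrow>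
    0 \<le> \<sigma> * Re (z - z0) \<and> 0 \<le> \<sigma> * Im (z - z0)"
proof -
  let ?C = "chron \<sigma> punctured (coords z0)"
  have sub: "?C \<subseteq> coords ` (- {0})"
    by (rule chron_subset[OF \<sigma>]) simp
  have "coords z \<in> closure ?C \<longleftrightarrow> 0 \<le> \<sigma> * Re (z - z0) \<and> 0 \<le> \<sigma> * Im (z - z0)"
  proof
    let ?H = "{x. \<sigma> * Re z0 \<le> \<sigma> * x 0} \<inter> {x. \<sigma> * Im z0 \<le> \<sigma> * x 1}"
    have "closed ?H"
      by (intro closed_Int closed_Collect_le continuous_intros continuous_on_product_coordinates)
    moreover have "?C \<subseteq> ?H"
    proof
      fix x assume x: "x \<in> ?C"
      then obtain w where "x = coords w" "w \<noteq> 0"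
        using sub by blast
      then show "x \<in> ?H"
        using x chron_punctured[OF \<sigma> nz(1), of w] by (simp add: right_diff_distrib)
    qed
    ultimately have "closure ?C \<subseteq> ?H"
      by (rule closure_minimal[rotated])
    then show "coords z \<in> closure ?C \<Longrightarrow> 0 \<le> \<sigma> * Re (z - z0) \<and> 0 \<le> \<sigma> * Im (z - z0)"
      by (auto simp: right_diff_distrib)
  next
    assume le: "0 \<le> \<sigma> * Re (z - z0) \<and> 0 \<le> \<sigma> * Im (z - z0)"
    \<comment> \<open>Moving along the diagonal enters the open cone from any point of the closed one.\<close>
    define w where "w n = z + of_real (\<sigma> / real (Suc n)) * (1 + \<i>)" for n
    have "(\<lambda>n. \<sigma> / real (Suc n)) \<longlonglongrightarrow> 0"
      using tendsto_mult_right_zero[OF LIMSEQ_inverse_real_of_nat, of \<sigma>] by (simp add: divide_inverse)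
    then have "w \<longlonglongrightarrow> z + of_real 0 * (1 + \<i>)"
      unfolding w_def by (intro tendsto_intros)
    then have lim: "w \<longlonglongrightarrow> z"
      by simp
    have "\<forall>\<^sub>F n in sequentially. w n \<noteq> 0"
      using lim nz(2) by (rule tendsto_imp_eventually_ne)
    then have "\<forall>\<^sub>F n in sequentially. coords (w n) \<in> closure ?C"
    proof eventually_elim
      fix n assume "w n \<noteq> 0"
      moreover have "\<sigma> * (\<sigma> / real (Suc n)) > 0"
        using \<sigma> by auto
      then have "0 < \<sigma> * Re (w n - z0) \<and> 0 < \<sigma> * Im (w n - z0)"
        using le by (simp add: w_def distrib_left right_diff_distrib)
      ultimately show "coords (w n) \<in> closure ?C"
        using chron_punctured[OF \<sigma> nz(1)] closure_subset by blast
    qed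
    moreover have "(\<lambda>n. coords (w n)) \<longlonglongrightarrow> coords z"
      by (rule continuous_on_tendsto_compose[OF continuous_on_coords[OF continuous_on_id[of UNIV]] lim]) auto
    ultimately show "coords z \<in> closure ?C"
      by (rule Lim_in_closed_set[OF closed_closure _ sequentially_bot])
  qed
  then show ?thesis
    unfolding closure_of_null_mfd[OF sub] using nz by blast
qed

lemma causally_continuous_punctured: "causally_continuous punctured"
proof -
  have refl: "coords z0 \<in> mtop punctured closure_of chron (- \<sigma>) punctured (coords z)"
    if "\<sigma> = 1 \<or> \<sigma> = - 1" "z0 \<noteq> 0" "z \<noteq> 0"
      "coords z \<in> mtop punctured closure_of chron \<sigma> punctured (coords z0)" for \<sigma> z0 z
  proof -
    have "- \<sigma> = 1 \<or> - \<sigma> = - 1"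
      using that(1) by auto
    from closure_chron_punctured[OF this that(3,2)] closure_chron_punctured[OF that(1-3)] that(4)
    show ?thesis
      by (simp add: right_diff_distrib)
  qed
  have eq: "z0 = z" if \<sigma>: "\<sigma> = 1 \<or> \<sigma> = - 1" and nz: "z0 \<noteq> 0" "z \<noteq> 0"
      and eq: "chron \<sigma> punctured (coords z0) = chron \<sigma> punctured (coords z)" for \<sigma> z0 z
  proof -
    have "0 \<le> \<sigma> * Re (z - z0) \<and> 0 \<le> \<sigma> * Im (z - z0)"
      using closure_chron_punctured[OF \<sigma> nz(2,2)] closure_chron_punctured[OF \<sigma> nz] eq by simp
    moreover have "0 \<le> \<sigma> * Re (z0 - z) \<and> 0 \<le> \<sigma> * Im (z0 - z)"
      using closure_chron_punctured[OF \<sigma> nz(1,1)] closure_chron_punctured[OF \<sigma> nz(2,1)] eq by simp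
    ultimately show ?thesis
      using \<sigma> by (auto simp: complex_eq_iff)
  qed
  have pts: "\<exists>z. p = coords z \<and> z \<noteq> 0" if "p \<in> topspace (mtop punctured)" for p
    using that by auto
  have "distinguishing punctured"
    unfolding distinguishing_def chron_future_eq chron_past_eq
    using eq[of 1] eq[of "- 1"] pts by metis
  moreover have "reflecting punctured"
    unfolding reflecting_def past_reflecting_def future_reflecting_def chron_future_eq chron_past_eq
    using refl[of 1] refl[of "- 1"] pts by (metis minus_minus)
  ultimately show ?thesis
    by (simp add: causally_continuous_def)
qed

section \<open>The universal covering is not past reflecting\<close>

text \<open>
  The curve is the lift of the straight segment from \<open>- 1\<close> to \<open>exp (2 \<i> \<alpha>)\<close>, which rises at the
  angle \<open>\<alpha>\<close> and passes above the origin at the distance \<open>sin \<alpha>\<close>. In the polar angle \<open>\<theta> = pi - s\<close> it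
  has the equation \<open>r = sin \<alpha> / sin (\<theta> - \<alpha>)\<close>, and \<open>sin (\<theta> - \<alpha>) = sin (s + \<alpha>)\<close>.
\<close>

lemma chron_cover_half_turn:
  assumes \<alpha>: "0 < \<alpha>" "\<alpha> < pi / 2"
  shows "coords (Complex 0 (2 * \<alpha>)) \<in> chron 1 cover (coords (Complex 0 pi))"
proof -
  define \<zeta> where "\<zeta> s = Complex (ln (sin \<alpha>) - ln (sin (s + \<alpha>))) (pi - s)" for s
  define \<zeta>' where "\<zeta>' s = Complex (- (cos (s + \<alpha>) / sin (s + \<alpha>))) (- 1)" for s
  have "timelike_arc 1 UNIV exp \<zeta> 0 (pi - 2 * \<alpha>)"
    unfolding timelike_arc_def
  proof (intro conjI exI[of _ \<zeta>'] ballI)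
    have sin_pos: "0 < sin (s + \<alpha>)" if "s \<in> {0..pi - 2 * \<alpha>}" for s
      using that \<alpha> by (intro sin_gt_zero) auto
    show "continuous_on {0..pi - 2 * \<alpha>} \<zeta>'"
      unfolding \<zeta>'_def Complex_eq using sin_pos by (force intro!: continuous_intros)
    fix s assume s: "s \<in> {0..pi - 2 * \<alpha>}"
    show "(\<zeta> has_vector_derivative \<zeta>' s) (at s within {0..pi - 2 * \<alpha>})"
      unfolding \<zeta>_def \<zeta>'_def using sin_pos[OF s]
      by (auto simp: has_vector_derivative_complex_iff intro!: derivative_eq_intros)
    have "Re (exp (\<zeta> s) * \<zeta>' s) =
        exp (Re (\<zeta> s)) * ((cos (s + \<alpha>) * cos s + sin (s + \<alpha>) * sin s) / sin (s + \<alpha>))"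
      using sin_pos[OF s] by (simp add: Re_exp Im_exp \<zeta>_def \<zeta>'_def field_simps)
    also have "cos (s + \<alpha>) * cos s + sin (s + \<alpha>) * sin s = cos \<alpha>"
      using cos_diff[of "s + \<alpha>" s] by simp
    finally show "0 < 1 * Re (exp (\<zeta> s) * \<zeta>' s)"
      using sin_pos[OF s] \<alpha> by (simp add: cos_gt_zero)
    have "Im (exp (\<zeta> s) * \<zeta>' s) =
        exp (Re (\<zeta> s)) * ((sin (s + \<alpha>) * cos s - cos (s + \<alpha>) * sin s) / sin (s + \<alpha>))"
      using sin_pos[OF s] by (simp add: Re_exp Im_exp \<zeta>_def \<zeta>'_def field_simps)
    also have "sin (s + \<alpha>) * cos s - cos (s + \<alpha>) * sin s = sin \<alpha>"
      using sin_diff[of "s + \<alpha>" s] by simp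
    finally show "0 < 1 * Im (exp (\<zeta> s) * \<zeta>' s)"
      using sin_pos[OF s] \<alpha> by (simp add: sin_gt_zero)
  qed (use \<alpha> in auto)
  from timelike_curve_null_mfdI[OF _ _ this]
  have "timelike_curve (oriented_timelike 1) cover (\<lambda>t. coords (\<zeta> t)) 0 (pi - 2 * \<alpha>)"
    by simp
  moreover have "\<zeta> 0 = Complex 0 pi" "\<zeta> (pi - 2 * \<alpha>) = Complex 0 (2 * \<alpha>)"
    using sin_pi_minus[of \<alpha>] by (simp_all add: \<zeta>_def algebra_simps)
  ultimately show ?thesis
    unfolding chron_def
    by (intro CollectI exI[of _ "\<lambda>t. coords (\<zeta> t)"] exI[of _ 0] exI[of _ "pi - 2 * \<alpha>"]) simp
qed

text \<open>
  Along a past-directed curve the second null coordinate \<open>Im (exp z)\<close> decreases from 0. To reach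
  positive angles \<open>Im z\<close>, the curve would have to cross the strip \<open>0 < Im z < pi\<close>, in which that
  coordinate is positive.
\<close>

lemma chron_past_cover_origin:
  assumes "q \<in> chron (- 1) cover (coords 0)"
  shows "q 1 \<le> 0"
proof -
  let ?L = "\<lambda>z. Im z \<le> 0 \<and> Im (exp z) \<le> 0"
  have "?L (point (coords 0)) \<longrightarrow> ?L (point q)"
  proof (rule chron_imp_transp(2)[OF _ _ assms])
    show "transp (\<lambda>z w. ?L z \<longrightarrow> ?L w)"
      by (auto intro!: transpI)
    fix \<zeta> a b assume arc: "timelike_arc (- 1) UNIV exp \<zeta> a b"
    show "?L (\<zeta> a) \<longrightarrow> ?L (\<zeta> b)"
    proof
      assume L: "?L (\<zeta> a)"
      have below: "Im (exp (\<zeta> t)) \<le> 0" if "t \<in> {a..b}" for t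
      proof (cases "t = a")
        case False
        then show ?thesis
          using that L null_coordinates_increase(2)[OF timelike_arc_subset[OF arc], of t exp]
          by (auto intro: DERIV_exp)
      qed (use L in simp)
      have "continuous_on {a..b} \<zeta>"
        using arc unfolding timelike_arc_def
        by (meson continuous_on_eq_continuous_within has_vector_derivative_continuous)
      then have cont: "continuous_on {a..b} (\<lambda>t. Im (\<zeta> t))"
        by (rule continuous_on_Im)
      have "Im (\<zeta> b) \<le> 0"
      proof (rule ccontr)
        assume pos: "\<not> Im (\<zeta> b) \<le> 0"
        have "a \<le> b"
          using arc by (simp add: timelike_arc_def)
        let ?c = "min (Im (\<zeta> b)) (pi / 2)"
        have "0 < ?c"
          using pos by simp
        then have "Im (\<zeta> a) \<le> ?c"
          using L by linarith
        from IVT'[of "\<lambda>t. Im (\<zeta> t)", OF this min.cobounded1 \<open>a \<le> b\<close> cont]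
        obtain t where t: "t \<in> {a..b}" "Im (\<zeta> t) = ?c"
          by auto
        then have "0 < sin (Im (\<zeta> t))"
          using pos pi_gt_zero by (intro sin_gt_zero) (auto simp: min_less_iff_disj)
        then show False
          using below[OF t(1)] by (simp add: Im_exp mult_le_0_iff)
      qed
      then show "?L (\<zeta> b)"
        using below[of b] arc by (simp add: timelike_arc_def)
    qed
  qed auto
  then have "Im (point q) \<le> 0"
    by simp
  then show ?thesis
    by (simp add: point_def)
qed

text \<open>
  The points over \<open>- 1\<close> and \<open>1\<close> at the angles \<open>pi\<close> and \<open>0\<close> violate past reflection: segments
  above the origin come arbitrarily close to the second one, but the past of the second one leaves
  it below the real axis.
\<close>

lemma not_past_reflecting_cover: "\<not> past_reflecting cover"
proof -
  let ?p = "coords (Complex 0 pi)" and ?q = "coords 0"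
  have sub: "chron \<sigma> cover p \<subseteq> coords ` UNIV" if "\<sigma> = 1 \<or> \<sigma> = - 1" for \<sigma> p
    by (rule chron_subset[OF that]) simp
  let ?\<alpha> = "\<lambda>n. inverse (real (Suc n))"
  have "?\<alpha> n \<le> 1" for n
    by (simp add: field_simps)
  moreover have "1 < pi / 2"
    using pi_gt3 by simp
  ultimately have "?\<alpha> n < pi / 2" for n
    by (meson le_less_trans)
  then have "coords (Complex 0 (2 * ?\<alpha> n)) \<in> closure (chron 1 cover ?p)" for n
    using chron_cover_half_turn[of "?\<alpha> n"] closure_subset by fastforce
  moreover have "(\<lambda>n. coords (Complex 0 (2 * ?\<alpha> n))) \<longlonglongrightarrow> coords 0"
  proof (rule continuous_on_tendsto_compose[OF continuous_on_coords[OF continuous_on_id[of UNIV]]])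
    show "(\<lambda>n. Complex 0 (2 * ?\<alpha> n)) \<longlonglongrightarrow> 0"
      using tendsto_mult_right_zero[OF LIMSEQ_inverse_real_of_nat, of 2] by (simp add: tendsto_complex_iff)
  qed auto
  ultimately have "?q \<in> closure (chron 1 cover ?p)"
    by (rule closed_sequentially[OF closed_closure])
  then have "?q \<in> mtop cover closure_of chron_future cover ?p"
    using closure_of_null_mfd[OF sub] by (simp add: chron_future_eq)
  moreover have "?p \<notin> mtop cover closure_of chron_past cover ?q"
  proof -
    have "closed {x :: nat \<Rightarrow> real. x 1 \<le> 0}"
      by (intro closed_Collect_le continuous_intros continuous_on_product_coordinates)
    then have "closure (chron (- 1) cover ?q) \<subseteq> {x. x 1 \<le> 0}"
      using chron_past_cover_origin by (intro closure_minimal) auto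
    moreover have "?p \<notin> {x. x 1 \<le> 0}"
      by (simp add: not_le)
    moreover have "mtop cover closure_of chron (- 1) cover ?q =
        coords ` UNIV \<inter> closure (chron (- 1) cover ?q)"
      by (rule closure_of_null_mfd[OF sub]) simp
    ultimately show ?thesis
      unfolding chron_past_eq by blast
  qed
  ultimately show ?thesis
    unfolding past_reflecting_def by auto
qed

section \<open>The exponential map as universal covering\<close>

text \<open>
The straight-line homotopy between two loops consists of loops.
\<close>

lemma simply_connected_space_plane: "simply_connected_space (top_of_set (coords ` UNIV))"
  unfolding simply_connected_space_def
proof (intro allI impI)
  fix p q :: "real \<Rightarrow> nat \<Rightarrow> real"
  assume "pathin (top_of_set (coords ` UNIV)) p \<and> p 1 = p 0 \<and> pathin (top_of_set (coords ` UNIV)) q \<and> q 1 = q 0"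
  then have p: "continuous_on {0..1} p" "\<And>t. t \<in> {0..1} \<Longrightarrow> p t \<in> plane" "p 1 = p 0"
    and q: "continuous_on {0..1} q" "\<And>t. t \<in> {0..1} \<Longrightarrow> q t \<in> plane" "q 1 = q 0"
    by (auto simp: pathin_def continuous_map_in_subtopology coords_image_UNIV)
  let ?h = "\<lambda>(s, t) i. (1 - s) * p t i + s * q t i"
  have "continuous_on ({0..1} \<times> {0..1}) ?h"
  proof (rule continuous_on_coordinatewise_then_product)
    fix i
    have "continuous_on ({0..1::real} \<times> {0..1}) (\<lambda>x. r (snd x) i)"
      if "continuous_on {0..1} r" for r :: "real \<Rightarrow> nat \<Rightarrow> real"
      by (rule continuous_on_compose2[OF continuous_on_product_then_coordinatewise[OF that]])
        (auto intro!: continuous_intros)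
    then show "continuous_on ({0..1} \<times> {0..1}) (\<lambda>x. ?h x i)"
      unfolding case_prod_beta using p(1) q(1) by (intro continuous_intros) auto
  qed
  moreover have "?h x \<in> plane" if "x \<in> {0..1} \<times> {0..1}" for x
    using that p(2) q(2) by (auto simp: plane_def)
  ultimately show "homotopic_with (\<lambda>r. r 1 = r 0) (top_of_set {0..1}) (top_of_set (coords ` UNIV)) p q"
    unfolding homotopic_with_def using p(3) q(3)
    by (intro exI[of _ ?h]) (auto simp: continuous_map_in_subtopology coords_image_UNIV)
qed

lemma openin_top_of_set_coords_image:
  assumes "open U" "U \<subseteq> W"
  shows "openin (top_of_set (coords ` W)) (coords ` U)"
  by (rule openin_subset_trans[OF openin_coords_image]) (use assms coords_in_plane in auto)

text \<open>
  The topological covering by \<open>exp\<close> is automatically a smooth one: on a sheet its inverse is the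
  inverse of an injective holomorphic function.
\<close>

lemma smooth_covering_cover_map: "smooth_covering cover cover_map punctured"
  unfolding smooth_covering_def
proof (intro conjI ballI)
  show "continuous_map (mtop cover) (mtop punctured) cover_map"
  proof -
    have "exp ` UNIV \<subseteq> - {0::complex}"
      by (auto simp del: image_subset_iff)
    then have "smooth_map_on cover (coords ` UNIV) punctured cover_map"
      by (intro smooth_map_on_holomorphic[where f = exp]) (auto intro: holomorphic_on_exp)
    then show ?thesis
      by (simp add: smooth_map_on_def subtopology_subtopology)
  qed
  show "cover_map ` topspace (mtop cover) = topspace (mtop punctured)"
    by (auto simp: image_iff) (metis exp_Ln point_coords)
next
  fix x assume "x \<in> topspace (mtop punctured)"
  then obtain z where z: "x = coords z" "z \<in> - {0}"
    by auto
  obtain T v where T: "z \<in> T" "openin (top_of_set (- {0})) T"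
    and v: "\<Union>v = UNIV \<inter> exp -` T" "\<And>U. U \<in> v \<Longrightarrow> open U" "pairwise disjnt v"
      "\<And>U. U \<in> v \<Longrightarrow> \<exists>q. homeomorphism U T exp q"
    using covering_space_exp_punctured_plane z(2) unfolding covering_space_def
    by (metis open_openin subtopology_UNIV)
  have T': "open T" "T \<subseteq> - {0}"
    using T(2) by (auto simp: openin_open_eq openin_imp_subset open_Compl)
  show "\<exists>T. x \<in> T \<and> openin (mtop punctured) T \<and>
    (\<exists>\<V>. \<Union>\<V> = topspace (mtop cover) \<inter> cover_map -` T \<and>
      (\<forall>U\<in>\<V>. openin (mtop cover) U) \<and> pairwise disjnt \<V> \<and>
      (\<forall>U\<in>\<V>. \<exists>\<sigma>.
        homeomorphic_maps (subtopology (mtop cover) U) (subtopology (mtop punctured) T) cover_map \<sigma> \<and>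
        smooth_map_on cover U punctured cover_map \<and> smooth_map_on punctured T cover \<sigma>))"
  proof (intro exI[of _ "coords ` T"] exI[of _ "image coords ` v"] conjI ballI)
    show "x \<in> coords ` T"
      using T(1) z(1) by blast
    show "openin (mtop punctured) (coords ` T)"
      using T' by (simp add: openin_top_of_set_coords_image)
    show "\<Union> (image coords ` v) = topspace (mtop cover) \<inter> cover_map -` (coords ` T)"
    proof -
      have "\<Union> (image coords ` v) = coords ` (\<Union>v)"
        by blast
      also have "\<dots> = topspace (mtop cover) \<inter> cover_map -` (coords ` T)"
        unfolding v(1) by (auto simp: coords_image_iff coords_point)
      finally show ?thesis .
    qed
    show "pairwise disjnt (image coords ` v)"
      using v(3) by (auto simp: pairwise_def disjnt_def image_Int[OF inj_coords, symmetric])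
    fix U' assume "U' \<in> image coords ` v"
    then obtain U where U: "U' = coords ` U" "U \<in> v"
      by blast
    show "openin (mtop cover) U'"
      using v(2)[OF U(2)] by (simp add: U(1) openin_top_of_set_coords_image)
    obtain q where hom: "homeomorphism U T exp q"
      using v(4) U(2) by blast
    then have im: "exp ` U = T" and inj: "inj_on exp U"
      unfolding homeomorphism_def by (auto intro: inj_on_inverseI)
    obtain g where g: "g holomorphic_on T" "\<And>z. z \<in> U \<Longrightarrow> g (exp z) = z"
      using holomorphic_has_inverse[OF holomorphic_on_exp v(2)[OF U(2)] inj] im by metis
    let ?\<sigma> = "\<lambda>x. coords (g (point x))"
    have smooth: "smooth_map_on cover U' punctured cover_map" "smooth_map_on punctured (coords ` T) cover ?\<sigma>"
      unfolding U(1) by (rule smooth_map_on_holomorphic; use v(2)[OF U(2)] g T' in \<open>auto intro: holomorphic_on_exp\<close>)+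
    have gT: "g w \<in> U \<and> exp (g w) = w" if "w \<in> T" for w
      using that g(2) unfolding im[symmetric] by auto
    have "homeomorphic_maps (subtopology (mtop cover) U') (subtopology (mtop punctured) (coords ` T)) cover_map ?\<sigma>"
      using smooth gT g(2) im T'(2)
      by (auto simp: homeomorphic_maps_def smooth_map_on_def subtopology_subtopology U(1)
          continuous_map_in_subtopology Int_absorb1 image_mono)
    with smooth show "\<exists>\<sigma>.
        homeomorphic_maps (subtopology (mtop cover) U') (subtopology (mtop punctured) (coords ` T)) cover_map \<sigma> \<and>
        smooth_map_on cover U' punctured cover_map \<and> smooth_map_on punctured (coords ` T) cover \<sigma>"
      by blast
  qed
qed

lemma spacetime_punctured: "spacetime punctured"
proof (rule spacetime_null_mfd)
  show "connected (- {0::complex})"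
    by (rule connected_punctured_universe) simp
  show "- {0::complex} \<noteq> {}"
    by (metis Compl_iff empty_iff singletonD zero_neq_one)
qed auto

lemma universal_covering_spacetime_cover: "universal_covering_spacetime cover cover_map punctured"
proof -
  have E: "spacetime cover"
    by (rule spacetime_null_mfd) (auto intro: holomorphic_on_exp)
  have deriv_exp: "deriv exp z = exp z" for z :: complex
    by (rule DERIV_imp_deriv[OF DERIV_exp])
  have "metric cover c p i j = pullback_metric punctured (coords ` UNIV, id) (coords ` (- {0}), id) cover_map p i j"
    if "p \<in> coords ` UNIV" "i < 2" "j < 2" for c p i j
    by (rule pullback_metric_holomorphic[where f = exp, symmetric])
      (use that in \<open>auto simp: deriv_exp holomorphic_on_exp\<close>)
  moreover have "future_timelike cover c p v \<longleftrightarrow> future_timelike punctured d (cover_map p)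
      (pushforward cover (coords ` UNIV, id) (coords ` (- {0}), id) cover_map p v)"
    if "p \<in> coords ` UNIV" for c d p v
  proof -
    have "point (pushforward cover (coords ` UNIV, id) (coords ` (- {0}), id) cover_map p v) =
        exp (point p) * point v"
      using that by (simp add: point_def[of "pushforward _ _ _ _ _ _"] complex_eq_iff deriv_exp
          pushforward_holomorphic[where f = exp] holomorphic_on_exp del: times_complex.simps)
    then show ?thesis
      by (simp add: future_timelike_eq oriented_timelike_null_mfd)
  qed
  ultimately show ?thesis
    unfolding universal_covering_spacetime_def
    using E spacetime_punctured simply_connected_space_plane smooth_covering_cover_map by auto
qed

theorem mainTheorem3:
  shows "\<exists>(M :: (nat \<Rightarrow> real) lorentz_mfd) (E :: (nat \<Rightarrow> real) lorentz_mfd) \<pi>.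
           spacetime M \<and> causally_continuous M \<and> reflecting M \<and>
           universal_covering_spacetime E \<pi> M \<and> \<not> past_reflecting E"
  using spacetime_punctured causally_continuous_punctured universal_covering_spacetime_cover
    not_past_reflecting_cover causally_continuous_def by blast

end
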